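(* Let $r_1,r_2\in\mathbb{Z}$ and let $(U_n)_{n\ge0}$ be a sequence of integers with $U_n=r_1U_{n-1}+r_2U_{n-2}$ for all $n\ge2$, where the roots of $x^2-r_1x-r_2$ are distinct. Then the sequence $(U_{n^2})_{n\ge1}$ almost satisfies the Dold condition.
   Context: A sequence of integers $(A_n)_{n\ge1}$ satisfies the Dold condition if $n\mid\sum_{d\mid n}\mu(d)A_{n/d}$ for every $n\in\mathbb{N}_+$ ($\mu$ the Möbius function). It almost satisfies the Dold condition if there is $c\in\mathbb{N}_+$ such that $(cA_n)_{n\ge1}$ satisfies the Dold condition. *)

theory Defs
  imports
    Complex_Main
    "HOL-Computational_Algebra.Polynomial"
    "HOL-Computational_Algebra.Squarefree"
begin

definition moebius_mu :: "nat \<Rightarrow> int" where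
  "moebius_mu n = (if squarefree n then (-1) ^ card (prime_factors n) else 0)"

text \<open>
  A sequence indexed by the positive integers is a function on \<^typ>\<open>nat\<close>
  whose value at 0 is irrelevant: for \<open>n > 0\<close> only values at positive
  indices occur below.
\<close>

definition dold :: "(nat \<Rightarrow> int) \<Rightarrow> bool" where
  "dold A \<longleftrightarrow> (\<forall>n>0. int n dvd (\<Sum>d | d dvd n. moebius_mu d * A (n div d)))"

definition almost_dold :: "(nat \<Rightarrow> int) \<Rightarrow> bool" where
  "almost_dold A \<longleftrightarrow> (\<exists>c::nat. c > 0 \<and> dold (\<lambda>n. int c * A n))"

end

theory Submission
  imports Defs
begin

text \<open>
  By a classical criterion, \<open>A\<close> satisfies the Dold condition as soon as
  \<open>p\<^sup>k\<close> divides \<open>A (p\<^sup>k m) - A (p\<^bsup>k-1\<^esup> m)\<close> for every prime \<open>p\<close> not dividing \<open>m\<close>. The numbers \<open>U n\<close>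
  are the images of the powers \<open>X\<^sup>n\<close> under a linear functional on \<open>\<int>[X]\<close> that vanishes on the
  multiples of \<open>f = X\<^sup>2 - r\<^sub>1 X - r\<^sub>2\<close>, so it suffices to compare powers of a root \<open>x\<close> of \<open>f\<close>.

  Modulo \<open>p\<close> the element \<open>y = x\<^sup>p\<close> is again a root of \<open>f\<close>, hence \<open>(y - x) y = (y - x) (r\<^sub>1 - x)\<close>:
  on multiples of \<open>y - x\<close> the Frobenius map acts on \<open>x\<close> as conjugation. Applying it twice gives
  \<open>(y - x) (z - x) = 0\<close> for \<open>z = x\<^bsup>p\<^sup>2\<^esup>\<close>, and since \<open>y - x\<close> divides \<open>z - x\<close> modulo \<open>p\<close>, it follows
  that \<open>(z - x)\<^sup>2 = 0\<close>. With \<open>D = r\<^sub>1\<^sup>2 + 4 r\<^sub>2\<close> this yields the congruences \<open>D z = D x\<close> and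
  \<open>z\<^sup>p = x\<^sup>p\<close> modulo \<open>p\<close>. The first one settles \<open>k = 1\<close> for the multiple \<open>D U\<close>. Raising the second
  one to the power \<open>p\<^bsup>2k-3\<^esup>\<close> lifts it to a congruence modulo \<open>p\<^bsup>2k-2\<^esup>\<close>, which suffices for
  \<open>k \<ge> 2\<close>.
\<close>

subsection \<open>The Dold condition at prime powers\<close>

lemma moebius_mu_prime_mult:
  assumes "prime p" and "\<not> p dvd d"
  shows "moebius_mu (p * d) = - moebius_mu d"
proof -
  have "d \<noteq> 0" using assms by (metis dvd_0_right)
  then have "prime_factors (p * d) = insert p (prime_factors d)"
    using assms by (simp add: prime_factors_product prime_prime_factors not_prime_0)
  moreover have "p \<notin> prime_factors d"
    using assms by auto
  moreover have "coprime p d"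
    using assms by (simp add: prime_imp_coprime)
  then have "squarefree (p * d) \<longleftrightarrow> squarefree d"
    using assms by (metis squarefree_mult_coprime squarefree_prime squarefree_multD(2))
  ultimately show ?thesis
    by (simp add: moebius_mu_def)
qed

lemma squarefree_dvd_prime_power_mult:
  fixes d p m :: "'a::factorial_semiring_gcd"
  assumes "squarefree d" and "prime p" and "d dvd p ^ k * m"
  shows "d dvd p * m"
proof (cases "p dvd d")
  case True
  then obtain e where e: "d = p * e" by (rule dvdE)
  have "\<not> p dvd e"
    using squarefreeD[OF \<open>squarefree d\<close>, of p] \<open>prime p\<close> e
    by (auto simp: power2_eq_square mult_dvd_mono)
  then have "coprime e (p ^ k)"
    using prime_imp_coprime[OF \<open>prime p\<close>] by (simp add: coprime_commute)
  moreover have "e dvd p ^ k * m"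
    using assms(3) e by (meson dvd_mult_right)
  ultimately show ?thesis
    using e by (simp add: coprime_dvd_mult_right_iff mult_dvd_mono)
next
  case False
  then have "coprime d (p ^ k)"
    using prime_imp_coprime[OF \<open>prime p\<close>] by (simp add: coprime_commute)
  then show ?thesis
    using assms(3) by (simp add: coprime_dvd_mult_right_iff)
qed

lemma divisors_prime_mult:
  fixes p m :: "'a::factorial_semiring_gcd"
  assumes "prime p"
  shows "{d. d dvd p * m} = {d. d dvd m} \<union> (*) p ` {d. d dvd m}"
proof (intro equalityI subsetI)
  fix d assume "d \<in> {d. d dvd p * m}"
  then have "d dvd p * m" by simp
  show "d \<in> {d. d dvd m} \<union> (*) p ` {d. d dvd m}"
  proof (cases "p dvd d")
    case True
    then obtain e where "d = p * e" by (rule dvdE)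
    then show ?thesis using \<open>d dvd p * m\<close> assms by auto
  next
    case False
    then have "coprime d p"
      using prime_imp_coprime[OF assms] by (simp add: coprime_commute)
    then show ?thesis using \<open>d dvd p * m\<close> by (simp add: coprime_dvd_mult_right_iff)
  qed
qed (auto intro: mult_dvd_mono)

lemma sum_moebius_mu_prime_power_mult:
  fixes g :: "nat \<Rightarrow> int"
  assumes "prime p" and "k > 0" and "\<not> p dvd m"
  shows "(\<Sum>d | d dvd p ^ k * m. moebius_mu d * g d) =
    (\<Sum>d | d dvd m. moebius_mu d * (g d - g (p * d)))"
proof -
  have pos: "p > 0" "m > 0"
    using assms by (auto simp: prime_gt_0_nat intro: gr0I)
  have "(\<Sum>d | d dvd p ^ k * m. moebius_mu d * g d) = (\<Sum>d | d dvd p * m. moebius_mu d * g d)"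
  proof (rule sum.mono_neutral_right)
    show "{d. d dvd p * m} \<subseteq> {d. d dvd p ^ k * m}"
      using \<open>k > 0\<close> by (auto intro: dvd_trans mult_dvd_mono)
    show "\<forall>d \<in> {d. d dvd p ^ k * m} - {d. d dvd p * m}. moebius_mu d * g d = 0"
      using squarefree_dvd_prime_power_mult[OF _ \<open>prime p\<close>] by (auto simp: moebius_mu_def)
  qed (use pos in simp)
  also have "\<dots> = (\<Sum>d | d dvd m. moebius_mu d * g d)
      + (\<Sum>d\<in>(*) p ` {d. d dvd m}. moebius_mu d * g d)"
    unfolding divisors_prime_mult[OF \<open>prime p\<close>] using assms(3) pos
    by (intro sum.union_disjoint) (auto dest: dvd_mult_left)
  also have "(\<Sum>d\<in>(*) p ` {d. d dvd m}. moebius_mu d * g d) =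
      (\<Sum>d | d dvd m. moebius_mu (p * d) * g (p * d))"
    using pos by (subst sum.reindex) (auto simp: inj_on_def)
  also have "\<dots> = (\<Sum>d | d dvd m. - moebius_mu d * g (p * d))"
  proof (rule sum.cong[OF refl])
    fix d assume "d \<in> {d. d dvd m}"
    then have "\<not> p dvd d" using assms(3) by (auto dest: dvd_trans)
    then show "moebius_mu (p * d) * g (p * d) = - moebius_mu d * g (p * d)"
      using moebius_mu_prime_mult[OF \<open>prime p\<close>] by simp
  qed
  finally show ?thesis
    by (simp add: right_diff_distrib flip: sum.distrib)
qed

lemma int_dvdI_prime_power:
  fixes n :: nat and a :: int
  assumes "n > 0" and "\<And>p. prime p \<Longrightarrow> int p ^ multiplicity p n dvd a"
  shows "int n dvd a"
proof (cases "a = 0")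
  case False
  have "n dvd nat \<bar>a\<bar>"
  proof (rule multiplicity_le_imp_dvd)
    fix p :: nat assume p: "prime p"
    have "int (p ^ multiplicity p n) dvd int (nat \<bar>a\<bar>)" using assms(2)[OF p] by simp
    then have "p ^ multiplicity p n dvd nat \<bar>a\<bar>" by (simp only: int_dvd_int_iff)
    then show "multiplicity p n \<le> multiplicity p (nat \<bar>a\<bar>)"
      using p False by (intro multiplicity_geI) auto
  qed (use \<open>n > 0\<close> in simp)
  then have "int n dvd int (nat \<bar>a\<bar>)" by (simp only: int_dvd_int_iff)
  then show ?thesis by simp
qed simp

lemma doldI_prime_power:
  assumes prime_power_dvd: "\<And>p k m. prime p \<Longrightarrow> k > 0 \<Longrightarrow> \<not> p dvd m \<Longrightarrow>
    int p ^ k dvd A (p ^ k * m) - A (p ^ (k - 1) * m)"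
  shows "dold A"
  unfolding dold_def
proof (intro allI impI int_dvdI_prime_power)
  fix n p :: nat assume "n > 0" and p: "prime p"
  define k where "k = multiplicity p n"
  show "int p ^ multiplicity p n dvd (\<Sum>d | d dvd n. moebius_mu d * A (n div d))"
  proof (cases "k = 0")
    case False
    then have "k > 0" by simp
    obtain m where n: "n = p ^ k * m" and not_dvd: "\<not> p dvd m"
      using multiplicity_decompose'[of n p] \<open>n > 0\<close> p unfolding k_def
      by (metis not_prime_unit neq0_conv)
    have "int p ^ k dvd A (n div d) - A (n div (p * d))" if "d dvd m" for d
    proof -
      have "n div d = p ^ k * (m div d)"
        using that by (simp add: n div_mult_swap)
      moreover have "n div (p * d) = p ^ (k - 1) * (m div d)"
        using that p unfolding n power_eq_if[of p k]
        by (simp add: False mult.assoc div_mult_swap prime_gt_0_nat)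
      moreover have "\<not> p dvd m div d"
        using not_dvd that by (metis dvd_mult_div_cancel dvd_mult)
      ultimately show ?thesis using prime_power_dvd[OF p \<open>k > 0\<close>] by simp
    qed
    then have "int p ^ k dvd (\<Sum>d | d dvd m. moebius_mu d * (A (n div d) - A (n div (p * d))))"
      by (intro dvd_sum dvd_mult) simp
    also have "\<dots> = (\<Sum>d | d dvd n. moebius_mu d * A (n div d))"
      using sum_moebius_mu_prime_power_mult[OF p \<open>k > 0\<close> not_dvd, of "\<lambda>d. A (n div d)"]
      by (simp flip: n)
    finally show ?thesis by (simp add: k_def)
  qed (simp flip: k_def)
qed

lemma dold_mult: "dold A \<Longrightarrow> dold (\<lambda>n. c * A n)"
  by (simp add: dold_def mult.left_commute flip: sum_distrib_left)

lemma almost_doldI: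
  assumes "c \<noteq> 0" and "dold (\<lambda>n. c * A n)"
  shows "almost_dold A"
proof -
  have "dold (\<lambda>n. sgn c * (c * A n))" by (rule dold_mult[OF assms(2)])
  moreover have "sgn c * (c * A n) = \<bar>c\<bar> * A n" for n
    by (simp add: abs_sgn mult_ac)
  ultimately show ?thesis
    using \<open>c \<noteq> 0\<close> unfolding almost_dold_def by (intro exI[of _ "nat \<bar>c\<bar>"]) simp
qed

subsection \<open>Congruences modulo an ideal\<close>

interpretation ideal: module "(*) :: 'a::comm_ring_1 \<Rightarrow> 'a \<Rightarrow> 'a"
  by unfold_locales (simp_all add: algebra_simps)

declare ideal.scale_scale [simp del] \<comment> \<open>rewrites against \<open>mult.assoc\<close>\<close>

definition ideal_cong :: "'a::comm_ring_1 \<Rightarrow> 'a \<Rightarrow> 'a set \<Rightarrow> bool"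
    (\<open>(\<open>indent=1 notation=\<open>mixfix ideal_cong\<close>\<close>[_ = _] '(ideal _'))\<close>)
  where "[x = y] (ideal S) \<longleftrightarrow> x - y \<in> ideal.span S"

lemma ideal_cong_refl [simp]: "[x = x] (ideal S)"
  by (simp add: ideal_cong_def ideal.span_zero)

lemma ideal_cong_sym: "[x = y] (ideal S) \<Longrightarrow> [y = x] (ideal S)"
  using ideal.span_neg[of "x - y" S] by (simp add: ideal_cong_def)

lemma ideal_cong_trans [trans]:
  "[x = y] (ideal S) \<Longrightarrow> [y = z] (ideal S) \<Longrightarrow> [x = z] (ideal S)"
  using ideal.span_add[of "x - y" S "y - z"] by (simp add: ideal_cong_def)

lemma ideal_cong_add:
  "[x = y] (ideal S) \<Longrightarrow> [u = v] (ideal S) \<Longrightarrow> [x + u = y + v] (ideal S)"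
  using ideal.span_add[of "x - y" S "u - v"] by (simp add: ideal_cong_def algebra_simps)

lemma ideal_cong_diff:
  "[x = y] (ideal S) \<Longrightarrow> [u = v] (ideal S) \<Longrightarrow> [x - u = y - v] (ideal S)"
  using ideal.span_diff[of "x - y" S "u - v"] by (simp add: ideal_cong_def algebra_simps)

lemma ideal_cong_mult_left: "[x = y] (ideal S) \<Longrightarrow> [c * x = c * y] (ideal S)"
  using ideal.span_scale[of "x - y" S c] by (simp add: ideal_cong_def right_diff_distrib)

lemma ideal_cong_mult:
  assumes "[x = y] (ideal S)" and "[u = v] (ideal S)"
  shows "[x * u = y * v] (ideal S)"
proof -
  have "[x * u = x * v] (ideal S)" by (rule ideal_cong_mult_left[OF assms(2)])
  also have "[x * v = y * v] (ideal S)"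
    using ideal_cong_mult_left[OF assms(1), of v] by (simp add: mult.commute)
  finally show ?thesis .
qed

lemma ideal_cong_power: "[x = y] (ideal S) \<Longrightarrow> [x ^ n = y ^ n] (ideal S)"
  by (induction n) (simp_all add: ideal_cong_mult)

lemma ideal_cong_sum:
  "(\<And>i. i \<in> A \<Longrightarrow> [f i = g i] (ideal S)) \<Longrightarrow> [sum f A = sum g A] (ideal S)"
  by (simp add: ideal_cong_def ideal.span_sum flip: sum_subtractf)

lemma ideal_cong_diff_0_iff: "[x - y = 0] (ideal S) \<longleftrightarrow> [x = y] (ideal S)"
  by (simp add: ideal_cong_def)

lemma ideal_cong_dvd_0: "[x = 0] (ideal S) \<Longrightarrow> x dvd y \<Longrightarrow> [y = 0] (ideal S)"
  by (metis dvdE ideal_cong_mult_left mult.commute mult_zero_left)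

lemma ideal_cong_mono: "[x = y] (ideal S) \<Longrightarrow> S \<subseteq> ideal.span T \<Longrightarrow> [x = y] (ideal T)"
  using ideal.span_minimal[of S "ideal.span T"] by (auto simp: ideal_cong_def)

lemma ideal_cong_insert_dvd:
  assumes "[x = y] (ideal (insert g S))" and "h dvd g"
  shows "[x = y] (ideal (insert h S))"
proof (rule ideal_cong_mono[OF assms(1)])
  have "[h = 0] (ideal (insert h S))"
    by (simp add: ideal_cong_def ideal.span_base)
  then have "g \<in> ideal.span (insert h S)"
    using ideal_cong_dvd_0[OF _ assms(2)] by (simp add: ideal_cong_def)
  then show "insert g S \<subseteq> ideal.span (insert h S)"
    by (auto intro: ideal.span_base)
qed

lemma ideal_cong_mult_power:
  assumes "[a * x = a * y] (ideal S)"
  shows "[a * x ^ n = a * y ^ n] (ideal S)"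
proof (induction n)
  case (Suc n)
  have "a * x ^ Suc n = x ^ n * (a * x)" by (simp only: power_Suc mult_ac)
  also have "[x ^ n * (a * x) = x ^ n * (a * y)] (ideal S)"
    by (rule ideal_cong_mult_left[OF assms])
  also have "x ^ n * (a * y) = y * (a * x ^ n)" by (simp only: mult_ac)
  also have "[y * (a * x ^ n) = y * (a * y ^ n)] (ideal S)"
    by (rule ideal_cong_mult_left[OF Suc.IH])
  also have "y * (a * y ^ n) = a * y ^ Suc n" by (simp only: power_Suc mult_ac)
  finally show ?case .
qed simp

lemma ideal_cong_mult_insert:
  assumes "[x = 0] (ideal (insert g S))" and "[y = 0] (ideal (insert h S))"
  shows "[x * y = 0] (ideal (insert (g * h) S))"
proof -
  obtain a b where x: "x - a * g \<in> ideal.span S" and y: "y - b * h \<in> ideal.span S"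
    using assms by (auto simp: ideal_cong_def ideal.span_insert)
  have "y * (x - a * g) + (a * g) * (y - b * h) \<in> ideal.span S"
    by (intro ideal.span_add ideal.span_scale x y)
  moreover have "y * (x - a * g) + (a * g) * (y - b * h) = x * y - (a * b) * (g * h)"
    by (simp add: algebra_simps)
  ultimately show ?thesis
    by (auto simp: ideal_cong_def ideal.span_insert)
qed

lemma ideal_cong_power_lift:
  assumes xy: "[x = y] (ideal (insert (of_nat p ^ j) S))" and "j > 0"
  shows "[x ^ p = y ^ p] (ideal (insert (of_nat p ^ Suc j) S))"
proof -
  let ?T = "insert (of_nat p) S"
  have "[x = y] (ideal ?T)"
    using xy by (rule ideal_cong_insert_dvd) (use \<open>j > 0\<close> in simp)
  then have "[y ^ (p - Suc i) * x ^ i = y ^ (p - Suc i) * y ^ i] (ideal ?T)" for i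
    by (intro ideal_cong_mult_left ideal_cong_power)
  then have "[(\<Sum>i<p. y ^ (p - Suc i) * x ^ i) = (\<Sum>i<p. y ^ (p - Suc i) * y ^ i)] (ideal ?T)"
    by (intro ideal_cong_sum)
  also have "(\<Sum>i<p. y ^ (p - Suc i) * y ^ i) = of_nat p * y ^ (p - 1)"
    by (simp flip: power_add)
  also have "[of_nat p * y ^ (p - 1) = 0] (ideal ?T)"
    by (rule ideal_cong_dvd_0[of "of_nat p"]) (simp_all add: ideal_cong_def ideal.span_base)
  finally have "[(x - y) * (\<Sum>i<p. y ^ (p - Suc i) * x ^ i) = 0]
      (ideal (insert (of_nat p ^ j * of_nat p) S))"
    using xy by (intro ideal_cong_mult_insert) (simp_all add: ideal_cong_diff_0_iff)
  then show ?thesis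
    by (simp only: power_diff_sumr2[symmetric] ideal_cong_diff_0_iff power_Suc2)
qed

lemma ideal_cong_power_power_lift:
  assumes "[x = y] (ideal (insert (of_nat p) S))"
  shows "[x ^ p ^ j = y ^ p ^ j] (ideal (insert (of_nat p ^ Suc j) S))"
proof (induction j)
  case (Suc j)
  from ideal_cong_power_lift[OF this] show ?case
    by (simp add: mult.commute flip: power_mult)
qed (use assms in simp)

subsection \<open>Frobenius on the roots of a quadratic\<close>

lemma prime_dvd_add_power_diff:
  fixes x y :: "'a::comm_ring_1"
  assumes p: "prime p"
  shows "of_nat p dvd (x + y) ^ p - (x ^ p + y ^ p)"
proof -
  have "p > 0" using p by (simp add: prime_gt_0_nat)
  then have "{..p} = insert 0 (insert p {0<..<p})" by auto
  then have "(x + y) ^ p - (x ^ p + y ^ p) =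
      (\<Sum>k\<in>{0<..<p}. of_nat (p choose k) * x ^ k * y ^ (p - k))"
    using \<open>p > 0\<close> by (simp add: binomial_ring)
  also have "of_nat p dvd \<dots>"
  proof (intro dvd_sum dvd_mult2)
    fix k assume "k \<in> {0<..<p}"
    then have "p dvd p choose k" using p by (intro dvd_choose_prime) auto
    then show "(of_nat p :: 'a) dvd of_nat (p choose k)" by (auto elim!: dvdE)
  qed
  finally show ?thesis .
qed

context
  fixes S :: "'a::comm_ring_1 set" and p :: nat
  assumes prime: "prime p" and char: "[of_nat p = 0] (ideal S)"
begin

lemma ideal_cong_add_power_prime: "[(x + y) ^ p = x ^ p + y ^ p] (ideal S)"
  using ideal_cong_dvd_0[OF char prime_dvd_add_power_diff[OF prime]]
  by (simp only: ideal_cong_diff_0_iff)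

lemma ideal_cong_diff_power_prime: "[(x - y) ^ p = x ^ p - y ^ p] (ideal S)"
  using ideal_cong_diff[OF ideal_cong_sym[OF ideal_cong_add_power_prime] ideal_cong_refl,
      of "x - y" y "y ^ p"]
  by simp

lemma ideal_cong_of_nat_power_prime: "[of_nat n ^ p = of_nat n] (ideal S)"
proof (induction n)
  case 0
  show ?case using prime by (simp add: prime_gt_0_nat zero_power)
next
  case (Suc n)
  have "[(1 + of_nat n) ^ p = 1 ^ p + of_nat n ^ p] (ideal S)"
    by (rule ideal_cong_add_power_prime)
  also have "[1 ^ p + of_nat n ^ p = 1 ^ p + of_nat n] (ideal S)"
    by (intro ideal_cong_add ideal_cong_refl Suc.IH)
  finally show ?case by simp
qed

lemma ideal_cong_of_int_power_prime: "[of_int a ^ p = of_int a] (ideal S)"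
proof (cases a rule: int_diff_cases)
  case (diff m n)
  have "[(of_nat m - of_nat n) ^ p = of_nat m ^ p - of_nat n ^ p] (ideal S)"
    by (rule ideal_cong_diff_power_prime)
  also have "[of_nat m ^ p - of_nat n ^ p = of_nat m - of_nat n] (ideal S)"
    by (intro ideal_cong_diff ideal_cong_of_nat_power_prime)
  finally show ?thesis by (simp add: diff)
qed

lemma quadratic_root_power_prime:
  assumes "[x\<^sup>2 = of_int r * x + of_int s] (ideal S)"
  shows "[(x ^ p)\<^sup>2 = of_int r * x ^ p + of_int s] (ideal S)"
proof -
  have "(x ^ p)\<^sup>2 = (x\<^sup>2) ^ p" by (simp add: mult.commute flip: power_mult)
  also have "[(x\<^sup>2) ^ p = (of_int r * x + of_int s) ^ p] (ideal S)"
    by (rule ideal_cong_power[OF assms])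
  also have "[(of_int r * x + of_int s) ^ p = (of_int r * x) ^ p + of_int s ^ p] (ideal S)"
    by (rule ideal_cong_add_power_prime)
  also have "(of_int r * x) ^ p + of_int s ^ p = of_int r ^ p * x ^ p + of_int s ^ p"
    by (simp add: power_mult_distrib)
  also have "[of_int r ^ p * x ^ p + of_int s ^ p = of_int r * x ^ p + of_int s] (ideal S)"
    by (intro ideal_cong_add ideal_cong_mult ideal_cong_of_int_power_prime ideal_cong_refl)
  finally show ?thesis .
qed

end

lemma quadratic_roots_diff_mult:
  assumes "[x\<^sup>2 = r * x + s] (ideal S)" and "[y\<^sup>2 = r * y + s] (ideal S)"
  shows "[(y - x) * y = (y - x) * (r - x)] (ideal S)"
proof -
  have "(y - x) * y - (y - x) * (r - x) = (y\<^sup>2 - (r * y + s)) - (x\<^sup>2 - (r * x + s))"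
    by (simp add: algebra_simps power2_eq_square)
  also have "\<dots> \<in> ideal.span S"
    by (rule ideal.span_diff) (use assms in \<open>simp_all add: ideal_cong_def\<close>)
  finally show ?thesis by (simp add: ideal_cong_def)
qed

lemma quadratic_roots_diff_square:
  assumes "[x\<^sup>2 = r * x + s] (ideal S)" and "[y\<^sup>2 = r * y + s] (ideal S)"
  shows "[(2 * x - r) * (y - x) = - (y - x)\<^sup>2] (ideal S)"
proof -
  have "(2 * x - r) * (y - x) = (y - x) * x - (y - x) * (r - x)"
    by (simp add: algebra_simps)
  also have "[(y - x) * x - (y - x) * (r - x) = (y - x) * x - (y - x) * y] (ideal S)"
    by (intro ideal_cong_diff ideal_cong_refl
        ideal_cong_sym[OF quadratic_roots_diff_mult[OF assms]])
  also have "(y - x) * x - (y - x) * y = - (y - x)\<^sup>2"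
    by (simp add: algebra_simps power2_eq_square)
  finally show ?thesis .
qed

context
  fixes S :: "'a::comm_ring_1 set" and p :: nat and x :: 'a and r s :: int
  assumes prime: "prime p" and char: "[of_nat p = 0] (ideal S)"
    and root: "[x\<^sup>2 = of_int r * x + of_int s] (ideal S)"
begin

lemma power_prime_diff_mult_cong_0:
  "[(x ^ p - x) * (x ^ p\<^sup>2 - x) = 0] (ideal S)"
proof -
  let ?a = "x ^ p - x"
  have conj: "[?a * x ^ p = ?a * (of_int r - x)] (ideal S)"
    by (rule quadratic_roots_diff_mult[OF root quadratic_root_power_prime[OF prime char root]])
  have "?a * x ^ p\<^sup>2 = ?a * (x ^ p) ^ p"
    by (simp add: power2_eq_square flip: power_mult)
  also have "[?a * (x ^ p) ^ p = ?a * (of_int r - x) ^ p] (ideal S)"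
    by (rule ideal_cong_mult_power[OF conj])
  also have "[?a * (of_int r - x) ^ p = ?a * (of_int r ^ p - x ^ p)] (ideal S)"
    by (intro ideal_cong_mult_left ideal_cong_diff_power_prime prime char)
  also have "[?a * (of_int r ^ p - x ^ p) = ?a * (of_int r - x ^ p)] (ideal S)"
    by (intro ideal_cong_mult_left ideal_cong_diff ideal_cong_of_int_power_prime
        ideal_cong_refl prime char)
  also have "?a * (of_int r - x ^ p) = ?a * of_int r - ?a * x ^ p"
    by (rule right_diff_distrib)
  also have "[?a * of_int r - ?a * x ^ p = ?a * of_int r - ?a * (of_int r - x)] (ideal S)"
    by (intro ideal_cong_diff ideal_cong_refl conj)
  also have "?a * of_int r - ?a * (of_int r - x) = ?a * x"
    by (simp add: algebra_simps)
  finally show ?thesis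
    by (simp add: right_diff_distrib ideal_cong_diff_0_iff)
qed

lemma power_prime_square_diff_square_cong_0: "[(x ^ p\<^sup>2 - x)\<^sup>2 = 0] (ideal S)"
proof -
  let ?a = "x ^ p - x" and ?c = "x ^ p\<^sup>2 - x"
  have power_a: "?a ^ p = ?a ^ (p - 1) * ?a"
    by (rule power_minus_mult[symmetric]) (rule prime_gt_0_nat[OF prime])
  have "[?a ^ p = x ^ p\<^sup>2 - x ^ p] (ideal S)"
    using ideal_cong_diff_power_prime[OF prime char, of "x ^ p" x]
    by (simp add: power2_eq_square flip: power_mult)
  from ideal_cong_add[OF ideal_cong_sym[OF this] ideal_cong_refl[of ?a]]
  have "[?c = ?a ^ p + ?a] (ideal S)" by simp
  then have "[?c * ?c = ?c * (?a ^ p + ?a)] (ideal S)"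
    by (rule ideal_cong_mult_left)
  also have "?c * (?a ^ p + ?a) = (?a ^ (p - 1) + 1) * (?a * ?c)"
    unfolding power_a by (simp only: distrib_left distrib_right mult_ac mult_1)
  also have "[(?a ^ (p - 1) + 1) * (?a * ?c) = 0] (ideal S)"
    using ideal_cong_mult_left[OF power_prime_diff_mult_cong_0] by fastforce
  finally show ?thesis by (simp add: power2_eq_square)
qed

lemma power_prime_cube_cong: "[x ^ p ^ 3 = x ^ p] (ideal S)"
proof -
  have "x ^ p ^ 3 - x ^ p = (x ^ p\<^sup>2) ^ p - x ^ p"
    by (simp add: power2_eq_square power3_eq_cube flip: power_mult)
  also have "[(x ^ p\<^sup>2) ^ p - x ^ p = (x ^ p\<^sup>2 - x) ^ p] (ideal S)"
    by (rule ideal_cong_sym[OF ideal_cong_diff_power_prime[OF prime char]])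
  also have "[(x ^ p\<^sup>2 - x) ^ p = 0] (ideal S)"
    using power_prime_square_diff_square_cong_0
    by (rule ideal_cong_dvd_0) (simp add: le_imp_power_dvd prime_ge_2_nat[OF prime])
  finally show ?thesis by (simp only: ideal_cong_diff_0_iff)
qed

lemma discriminant_mult_power_prime_square_cong:
  "[of_int (r\<^sup>2 + 4 * s) * x ^ p\<^sup>2 = of_int (r\<^sup>2 + 4 * s) * x] (ideal S)"
proof -
  let ?z = "x ^ p\<^sup>2" and ?\<theta> = "2 * x - of_int r" and ?D = "r\<^sup>2 + 4 * s"
  have "[?z\<^sup>2 = of_int r * ?z + of_int s] (ideal S)"
    using quadratic_root_power_prime[OF prime char quadratic_root_power_prime[OF prime char root]]
    by (simp add: power2_eq_square flip: power_mult)
  then have "[?\<theta> * (?z - x) = - (?z - x)\<^sup>2] (ideal S)"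
    by (rule quadratic_roots_diff_square[OF root])
  also have "[- (?z - x)\<^sup>2 = 0] (ideal S)"
    using power_prime_square_diff_square_cong_0 by (rule ideal_cong_dvd_0) simp
  finally have \<theta>_mult: "[?\<theta> * (?z - x) = 0] (ideal S)" .
  have "of_int ?D - ?\<theta>\<^sup>2 = - 4 * (x\<^sup>2 - (of_int r * x + of_int s))"
    by (simp add: algebra_simps power2_eq_square)
  also have "\<dots> \<in> ideal.span S"
    using root unfolding ideal_cong_def by (rule ideal.span_scale)
  finally have "[of_int ?D = ?\<theta>\<^sup>2] (ideal S)"
    by (simp only: ideal_cong_def)
  then have "[of_int ?D * (?z - x) = ?\<theta>\<^sup>2 * (?z - x)] (ideal S)"
    by (intro ideal_cong_mult ideal_cong_refl)
  also have "[?\<theta>\<^sup>2 * (?z - x) = 0] (ideal S)"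
    using \<theta>_mult by (rule ideal_cong_dvd_0) (simp add: power2_eq_square mult.assoc)
  finally show ?thesis
    by (simp only: right_diff_distrib ideal_cong_diff_0_iff)
qed

end

lemma discriminant_mult_power_square_cong:
  fixes x :: "'a::comm_ring_1" and r s :: int
  assumes root: "[x\<^sup>2 = of_int r * x + of_int s] (ideal S)" and p: "prime p" and "k > 0"
  shows "[of_int (r\<^sup>2 + 4 * s) * x ^ (p ^ k * m)\<^sup>2
    = of_int (r\<^sup>2 + 4 * s) * x ^ (p ^ (k - 1) * m)\<^sup>2] (ideal (insert (of_nat p ^ k) S))"
proof -
  let ?D = "of_int (r\<^sup>2 + 4 * s) :: 'a"
  have char: "[of_nat p = 0] (ideal (insert (of_nat p) S))"
    by (simp add: ideal_cong_def ideal.span_base)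
  have root': "[x\<^sup>2 = of_int r * x + of_int s] (ideal (insert (of_nat p) S))"
    using root by (rule ideal_cong_mono) (auto intro: ideal.span_base)
  show ?thesis
  proof (cases "k = 1")
    case True
    from discriminant_mult_power_prime_square_cong[OF p char root']
    have "[?D * (x ^ p\<^sup>2) ^ m\<^sup>2 = ?D * x ^ m\<^sup>2] (ideal (insert (of_nat p) S))"
      by (rule ideal_cong_mult_power)
    then show ?thesis using True by (simp add: power_mult_distrib power_mult)
  next
    case False
    define j where "j = 2 * k - 3"
    have j: "2 * k = 3 + j" "2 * (k - 1) = 1 + j" "k \<le> Suc j"
      using False \<open>k > 0\<close> by (auto simp: j_def)
    have "(p ^ k * m)\<^sup>2 = p ^ (2 * k) * m\<^sup>2" "(p ^ (k - 1) * m)\<^sup>2 = p ^ (2 * (k - 1)) * m\<^sup>2"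
      by (simp_all add: power_mult_distrib mult.commute flip: power_mult)
    then have exponents:
      "(p ^ k * m)\<^sup>2 = p ^ 3 * p ^ j * m\<^sup>2" "(p ^ (k - 1) * m)\<^sup>2 = p * p ^ j * m\<^sup>2"
      unfolding j by (simp_all add: power_add)
    have "[(x ^ p ^ 3) ^ p ^ j = (x ^ p) ^ p ^ j] (ideal (insert (of_nat p ^ Suc j) S))"
      by (intro ideal_cong_power_power_lift power_prime_cube_cong[OF p char root'])
    then have "[(x ^ p ^ 3) ^ p ^ j = (x ^ p) ^ p ^ j] (ideal (insert (of_nat p ^ k) S))"
      by (rule ideal_cong_insert_dvd) (use j in \<open>intro le_imp_power_dvd\<close>)
    then show ?thesis
      unfolding exponents power_mult by (rule ideal_cong_mult_left[OF ideal_cong_power])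
  qed
qed

subsection \<open>Linear recurrences\<close>

definition umbral :: "(nat \<Rightarrow> 'a) \<Rightarrow> 'a::comm_ring_1 poly \<Rightarrow> 'a" where
  "umbral u P = (\<Sum>i\<le>degree P. coeff P i * u i)"

lemma umbral_altdef:
  assumes "degree P \<le> n"
  shows "umbral u P = (\<Sum>i\<le>n. coeff P i * u i)"
  unfolding umbral_def using assms
  by (intro sum.mono_neutral_left) (auto simp: coeff_eq_0)

lemma umbral_0 [simp]: "umbral u 0 = 0"
  by (simp add: umbral_def)

lemma umbral_add: "umbral u (P + Q) = umbral u P + umbral u Q"
proof -
  let ?n = "max (degree P) (degree Q)"
  have "degree (P + Q) \<le> ?n" by (rule degree_add_le_max)
  then show ?thesis
    by (simp add: umbral_altdef[of _ ?n] sum.distrib algebra_simps)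
qed

lemma umbral_diff: "umbral u (P - Q) = umbral u P - umbral u Q"
  using umbral_add[of u "P - Q" Q] by simp

lemma umbral_smult: "umbral u (smult c P) = c * umbral u P"
  by (simp add: umbral_altdef[of _ "degree P"] degree_smult_le sum_distrib_left mult.assoc)

lemma umbral_pCons: "umbral u (pCons a P) = a * u 0 + umbral (\<lambda>n. u (Suc n)) P"
proof -
  have "umbral u (pCons a P) = (\<Sum>i\<le>Suc (degree P). coeff (pCons a P) i * u i)"
    by (rule umbral_altdef) (rule degree_pCons_le)
  also have "\<dots> = a * u 0 + (\<Sum>i\<le>degree P. coeff P i * u (Suc i))"
    by (subst sum.atMost_Suc_shift) simp
  finally show ?thesis by (simp add: umbral_def)
qed

lemma umbral_X_power: "umbral u ([:0, 1:] ^ n) = u n"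
  by (induction n arbitrary: u) (simp_all add: umbral_pCons one_pCons)

lemma umbral_recurrence_mult:
  assumes "\<And>n. umbral (\<lambda>i. u (n + i)) F = 0"
  shows "umbral u (F * P) = 0"
  using assms
proof (induction P arbitrary: u)
  case (pCons c P)
  have "umbral (\<lambda>n. u (Suc n)) (F * P) = 0"
    using pCons.prems[of "Suc _"] by (intro pCons.IH) simp
  then show ?case
    using pCons.prems[of 0] by (simp add: umbral_add umbral_smult umbral_pCons)
qed simp

lemma dvd_umbral_diff:
  assumes "[P = Q] (ideal {[:c:], F})" and "\<And>n. umbral (\<lambda>i. u (n + i)) F = 0"
  shows "c dvd umbral u P - umbral u Q"
proof -
  obtain A B where "P - Q - A * [:c:] = B * F"
    using assms(1) by (auto simp: ideal_cong_def ideal.span_insert ideal.span_singleton)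
  then have "P - Q = smult c A + F * B" by (simp add: algebra_simps)
  then have "umbral u (P - Q) = c * umbral u A"
    by (simp add: umbral_add umbral_smult umbral_recurrence_mult[OF assms(2)])
  then show ?thesis by (simp add: umbral_diff)
qed

lemma quadratic_recurrence_prime_power_dvd:
  fixes r s :: int and u :: "nat \<Rightarrow> int"
  assumes rec: "\<And>n. u (n + 2) = r * u (n + 1) + s * u n" and "prime p" and "k > 0"
  shows "int p ^ k dvd
    (r\<^sup>2 + 4 * s) * u ((p ^ k * m)\<^sup>2) - (r\<^sup>2 + 4 * s) * u ((p ^ (k - 1) * m)\<^sup>2)"
proof -
  let ?D = "r\<^sup>2 + 4 * s" and ?F = "[:- s, - r, 1:]" and ?X = "[:0, 1:] :: int poly"
  have "?X\<^sup>2 - (of_int r * ?X + of_int s) = ?F" by (simp add: power2_eq_square of_int_poly)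
  then have "[?X\<^sup>2 = of_int r * ?X + of_int s] (ideal {?F})"
    by (simp only: ideal_cong_def ideal.span_base singletonI)
  from discriminant_mult_power_square_cong[OF this \<open>prime p\<close> \<open>k > 0\<close>, of m]
  have "[smult ?D (?X ^ (p ^ k * m)\<^sup>2) = smult ?D (?X ^ (p ^ (k - 1) * m)\<^sup>2)]
      (ideal {[:int p ^ k:], ?F})"
    by (simp only: of_int_poly of_nat_poly poly_const_pow) simp
  moreover have "umbral (\<lambda>i. u (n + i)) ?F = 0" for n
    using rec[of n] by (simp add: umbral_pCons numeral_2_eq_2)
  ultimately have "int p ^ k dvd umbral u (smult ?D (?X ^ (p ^ k * m)\<^sup>2))
      - umbral u (smult ?D (?X ^ (p ^ (k - 1) * m)\<^sup>2))"
    by (rule dvd_umbral_diff)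
  then show ?thesis
    by (simp only: umbral_smult umbral_X_power)
qed

lemma roots_monic_quadratic_discriminant_0:
  fixes a b :: "'a::field_char_0"
  assumes "a\<^sup>2 + 4 * b = 0"
  shows "{x. poly [:- b, - a, 1:] x = 0} = {a / 2}"
proof -
  have "b = - (a\<^sup>2 / 4)"
    using assms by (simp add: eq_neg_iff_add_eq_0 field_simps)
  then have "poly [:- b, - a, 1:] x = (x - a / 2)\<^sup>2" for x
    by (simp add: power2_eq_square field_simps)
  then have "poly [:- b, - a, 1:] x = 0 \<longleftrightarrow> x = a / 2" for x
    by (simp only: zero_eq_power2) simp
  then show ?thesis by (simp only: singleton_conv)
qed

theorem theorem4:
  fixes r1 r2 :: int and U :: "nat \<Rightarrow> int"
  assumes rec: "\<And>n. n \<ge> 2 \<Longrightarrow> U n = r1 * U (n - 1) + r2 * U (n - 2)"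
    and distinct_roots:
      "card {x :: complex. poly [:- of_int r2, - of_int r1, 1:] x = 0} = 2"
  shows "almost_dold (\<lambda>n. U (n\<^sup>2))"
proof (rule almost_doldI)
  show "dold (\<lambda>n. (r1\<^sup>2 + 4 * r2) * U (n\<^sup>2))"
  proof (rule doldI_prime_power)
    have "U (n + 2) = r1 * U (n + 1) + r2 * U n" for n
      using rec[of "n + 2"] by simp
    then show "int p ^ k dvd (r1\<^sup>2 + 4 * r2) * U ((p ^ k * m)\<^sup>2)
        - (r1\<^sup>2 + 4 * r2) * U ((p ^ (k - 1) * m)\<^sup>2)" if "prime p" "k > 0" for p k m
      using that by (rule quadratic_recurrence_prime_power_dvd)
  qed
  show "r1\<^sup>2 + 4 * r2 \<noteq> 0"
  proof
    assume "r1\<^sup>2 + 4 * r2 = 0"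
    then have "of_int (r1\<^sup>2 + 4 * r2) = (0 :: complex)" by (simp only: of_int_0)
    then have "(of_int r1)\<^sup>2 + 4 * of_int r2 = (0 :: complex)" by simp
    from roots_monic_quadratic_discriminant_0[OF this] show False using distinct_roots by simp
  qed
qed

end
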